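(* Let $G$ be a finite group, $n\ge 1$, and let $\widetilde{G}_n=G^n\rtimes S_n$ be the wreath product of $G$ by $S_n$. The Baxterized elements $s_i(c,c'):=s_i+\dfrac{e_{i,i+1}}{c-c'}$, $i=1,\dots,n-1$, of $\mathbb{C}\widetilde{G}_n$ (rational functions of the spectral parameters $c,c'$) satisfy the Yang--Baxter equation with spectral parameters $$s_i(c,c')\,s_{i+1}(c,c'')\,s_i(c',c'')=s_{i+1}(c',c'')\,s_i(c,c'')\,s_{i+1}(c,c')\qquad\text{for } i=1,\dots,n-2;$$ they also satisfy $$s_i(c,c')\,s_j(d,d')=s_j(d,d')\,s_i(c,c')\qquad\text{for } i,j=1,\dots,n-1 \text{ such that } |i-j|>1,$$ $$s_i(c,c')\,s_i(c',c)=1-\frac{e_{i,i+1}^2}{(c-c')^2}\qquad\text{for } i=1,\dots,n-1.$$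
   Context: $S_n$ acts on $G^n$ by permuting the $n$ copies of $G$, and $\widetilde{G}_n=G^n\rtimes S_n$ has multiplication $(a,\sigma)(a',\sigma')=(a\,\sigma(a'),\sigma\sigma')$. $s_i:=(1_{G^n},\pi_i)\in\widetilde{G}_n$ where $\pi_i$ is the transposition $(i,i+1)$. For $g\in G$ and $j=1,\dots,n$, $g_j\in\widetilde{G}_n$ denotes the element of $G^n\subset\widetilde{G}_n$ with $g$ in the $j$-th position and $1_G$ elsewhere. For $i\neq j$, $e_{i,j}:=\frac{1}{|G|}\sum_{g\in G}g_i\,(g^{-1})_j\in\mathbb{C}\widetilde{G}_n$. *)

theory Defs
  imports Complex_Main "HOL-Algebra.Algebra"
begin

definition semidirect_product ::
    "('a, 'm) monoid_scheme \<Rightarrow> ('b, 'n) monoid_scheme \<Rightarrow> ('b \<Rightarrow> 'a \<Rightarrow> 'a) \<Rightarrow> ('a \<times> 'b) monoid"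
  where "semidirect_product N H \<phi> =
    \<lparr> carrier = carrier N \<times> carrier H,
      monoid.mult = (\<lambda>(a, \<sigma>) (a', \<sigma>'). (a \<otimes>\<^bsub>N\<^esub> \<phi> \<sigma> a', \<sigma> \<otimes>\<^bsub>H\<^esub> \<sigma>')),
      one = (\<one>\<^bsub>N\<^esub>, \<one>\<^bsub>H\<^esub>) \<rparr>"

abbreviation direct_power :: "('a, 'm) monoid_scheme \<Rightarrow> nat \<Rightarrow> (nat \<Rightarrow> 'a) monoid"
  where "direct_power G n \<equiv> product_group {1..n} (\<lambda>_. G)"

(* The left action: the entry in position k is moved to position \<sigma> k. *)
definition permute_copies :: "nat \<Rightarrow> (nat \<Rightarrow> nat) \<Rightarrow> (nat \<Rightarrow> 'a) \<Rightarrow> (nat \<Rightarrow> 'a)"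
  where "permute_copies n \<sigma> a = (\<lambda>k\<in>{1..n}. a (inv_into UNIV \<sigma> k))"

definition wreath :: "('a, 'm) monoid_scheme \<Rightarrow> nat \<Rightarrow> ((nat \<Rightarrow> 'a) \<times> (nat \<Rightarrow> nat)) monoid"
  where "wreath G n = semidirect_product (direct_power G n) (sym_group n) (permute_copies n)"

definition wreath_s :: "('a, 'm) monoid_scheme \<Rightarrow> nat \<Rightarrow> nat \<Rightarrow> (nat \<Rightarrow> 'a) \<times> (nat \<Rightarrow> nat)"
  where "wreath_s G n i = (\<one>\<^bsub>direct_power G n\<^esub>, transpose i (i + 1))"

definition wreath_at ::
    "('a, 'm) monoid_scheme \<Rightarrow> nat \<Rightarrow> nat \<Rightarrow> 'a \<Rightarrow> (nat \<Rightarrow> 'a) \<times> (nat \<Rightarrow> nat)"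
  where "wreath_at G n j g = ((\<lambda>k\<in>{1..n}. if k = j then g else \<one>\<^bsub>G\<^esub>), id)"

(* An element \<Sum>h. f h h of the complex group algebra is its coefficient function f, extended by
   zero outside the group. The sum in the product is finite because of the finite supports. *)
definition group_algebra :: "('h, 'm) monoid_scheme \<Rightarrow> (complex, 'h \<Rightarrow> complex) module"
  where "group_algebra H =
    \<lparr> carrier = {f. finite {h. f h \<noteq> 0} \<and> {h. f h \<noteq> 0} \<subseteq> carrier H},
      monoid.mult = (\<lambda>f f' h. \<Sum>(x, y) | f x \<noteq> 0 \<and> f' y \<noteq> 0 \<and> x \<otimes>\<^bsub>H\<^esub> y = h. f x * f' y),
      one = (\<lambda>h. if h = \<one>\<^bsub>H\<^esub> then 1 else 0),
      ring.zero = (\<lambda>h. 0),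
      ring.add = (\<lambda>f f' h. f h + f' h),
      module.smult = (\<lambda>z f h. z * f h) \<rparr>"

definition group_elem :: "'h \<Rightarrow> ('h \<Rightarrow> complex)"
  where "group_elem x = (\<lambda>h. if h = x then 1 else 0)"

abbreviation wreath_algebra ::
    "('a, 'm) monoid_scheme \<Rightarrow> nat \<Rightarrow> (complex, (nat \<Rightarrow> 'a) \<times> (nat \<Rightarrow> nat) \<Rightarrow> complex) module"
  where "wreath_algebra G n \<equiv> group_algebra (wreath G n)"

definition wreath_e ::
    "('a, 'm) monoid_scheme \<Rightarrow> nat \<Rightarrow> nat \<Rightarrow> nat \<Rightarrow> (nat \<Rightarrow> 'a) \<times> (nat \<Rightarrow> nat) \<Rightarrow> complex"
  where "wreath_e G n i j =
    (1 / of_nat (order G)) \<odot>\<^bsub>wreath_algebra G n\<^esub>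
      (\<Oplus>\<^bsub>wreath_algebra G n\<^esub> g \<in> carrier G.
        group_elem (wreath_at G n i g \<otimes>\<^bsub>wreath G n\<^esub> wreath_at G n j (inv\<^bsub>G\<^esub> g)))"

(* A rational function of c, c', given by its values; meaningful only for c \<noteq> c',
   since division by zero yields zero here. *)
definition baxterized ::
    "('a, 'm) monoid_scheme \<Rightarrow> nat \<Rightarrow> nat \<Rightarrow> complex \<Rightarrow> complex
      \<Rightarrow> (nat \<Rightarrow> 'a) \<times> (nat \<Rightarrow> nat) \<Rightarrow> complex"
  where "baxterized G n i c c' =
    group_elem (wreath_s G n i) \<oplus>\<^bsub>wreath_algebra G n\<^esub>
      (1 / (c - c')) \<odot>\<^bsub>wreath_algebra G n\<^esub> wreath_e G n i (i + 1)"

end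

theory Submission
  imports Defs
begin

text \<open>Conjugation by \<open>s\<^sub>i\<close> permutes the indices of the \<open>e\<^sub>j\<^sub>k\<close>, and \<open>e\<^sub>i\<^sub>j e\<^sub>j\<^sub>k = e\<^sub>j\<^sub>k e\<^sub>k\<^sub>i\<close>
  for distinct \<open>i, j, k\<close>. With \<open>u = 1/(c - c')\<close>, \<open>v = 1/(c - c'')\<close>, \<open>w = 1/(c' - c'')\<close> both sides of
  the Yang--Baxter equation are expanded in powers of the \<open>e\<close>'s. The terms of degree 0, 1 and 3
  agree one by one; in degree 2 only two different words occur, and their coefficients match
  because \<open>u w = v (u + w)\<close>.\<close>

section \<open>The group algebra\<close>

text \<open>Index pairs outside the supports contribute 0, so any finite supersets \<open>S\<close>
  and \<open>T\<close> may serve as index sets. This allows products with different factors to be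
  expanded over one common set.\<close>

lemma group_algebra_mult_eq_sum:
  assumes "finite S" "{x. f x \<noteq> 0} \<subseteq> S" "finite T" "{y. g y \<noteq> 0} \<subseteq> T"
  shows "(f \<otimes>\<^bsub>group_algebra H\<^esub> g) h
    = (\<Sum>x\<in>S. \<Sum>y\<in>T. if x \<otimes>\<^bsub>H\<^esub> y = h then f x * g y else 0)"
proof -
  have "(f \<otimes>\<^bsub>group_algebra H\<^esub> g) h
      = (\<Sum>(x, y)\<in>{(x, y). f x \<noteq> 0 \<and> g y \<noteq> 0 \<and> x \<otimes>\<^bsub>H\<^esub> y = h}. f x * g y)"
    by (simp add: group_algebra_def)
  also have "\<dots> = (\<Sum>(x, y)\<in>S \<times> T. if x \<otimes>\<^bsub>H\<^esub> y = h then f x * g y else 0)"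
    using assms by (intro sum.mono_neutral_cong_left) (auto split: if_splits)
  also have "\<dots> = (\<Sum>x\<in>S. \<Sum>y\<in>T. if x \<otimes>\<^bsub>H\<^esub> y = h then f x * g y else 0)"
    by (rule sum.cartesian_product [symmetric])
  finally show ?thesis .
qed

text \<open>If no two support elements multiply to \<open>h\<close>, the defining sum is empty. The
  bound yields closure under multiplication and supplies finite index sets for iterated
  products.\<close>

lemma group_algebra_mult_support:
  "{h. (f \<otimes>\<^bsub>group_algebra H\<^esub> g) h \<noteq> 0}
    \<subseteq> (\<lambda>(x, y). x \<otimes>\<^bsub>H\<^esub> y) ` ({x. f x \<noteq> 0} \<times> {y. g y \<noteq> 0})"
proof
  fix h
  assume "h \<in> {h. (f \<otimes>\<^bsub>group_algebra H\<^esub> g) h \<noteq> 0}"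
  then have "{(x, y). f x \<noteq> 0 \<and> g y \<noteq> 0 \<and> x \<otimes>\<^bsub>H\<^esub> y = h} \<noteq> {}"
    by (intro notI) (simp add: group_algebra_def)
  then show "h \<in> (\<lambda>(x, y). x \<otimes>\<^bsub>H\<^esub> y) ` ({x. f x \<noteq> 0} \<times> {y. g y \<noteq> 0})"
    by auto
qed

text \<open>Summing a product against a test function \<open>\<phi>\<close> removes the constraint on the index pairs;
  associativity is the special case of indicator functions.\<close>

lemma sum_group_algebra_mult:
  assumes "finite S" "{x. f x \<noteq> 0} \<subseteq> S" "finite T" "{y. g y \<noteq> 0} \<subseteq> T"
    and "finite Z" "\<And>x y. x \<in> S \<Longrightarrow> y \<in> T \<Longrightarrow> x \<otimes>\<^bsub>H\<^esub> y \<in> Z"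
  shows "(\<Sum>z\<in>Z. (f \<otimes>\<^bsub>group_algebra H\<^esub> g) z * \<phi> z)
    = (\<Sum>x\<in>S. \<Sum>y\<in>T. f x * g y * \<phi> (x \<otimes>\<^bsub>H\<^esub> y))"
proof -
  have "(\<Sum>z\<in>Z. (f \<otimes>\<^bsub>group_algebra H\<^esub> g) z * \<phi> z)
      = (\<Sum>z\<in>Z. \<Sum>x\<in>S. \<Sum>y\<in>T. if x \<otimes>\<^bsub>H\<^esub> y = z then f x * g y * \<phi> z else 0)"
    by (simp add: group_algebra_mult_eq_sum [OF assms(1-4)] sum_distrib_right if_distrib [of "\<lambda>t. t * _"]
        cong: if_cong)
  also have "\<dots> = (\<Sum>x\<in>S. \<Sum>y\<in>T. \<Sum>z\<in>Z. if x \<otimes>\<^bsub>H\<^esub> y = z then f x * g y * \<phi> z else 0)"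
    by (subst sum.swap, rule sum.cong [OF refl], rule sum.swap)
  also have "\<dots> = (\<Sum>x\<in>S. \<Sum>y\<in>T. f x * g y * \<phi> (x \<otimes>\<^bsub>H\<^esub> y))"
    using assms(5,6) by (intro sum.cong refl) (simp add: sum.delta)
  finally show ?thesis .
qed

lemma group_algebra_add [simp]: "(f \<oplus>\<^bsub>group_algebra H\<^esub> g) h = f h + g h"
  and group_algebra_zero [simp]: "\<zero>\<^bsub>group_algebra H\<^esub> h = 0"
  and group_algebra_smult [simp]: "(z \<odot>\<^bsub>group_algebra H\<^esub> f) h = z * f h"
  and group_algebra_one: "\<one>\<^bsub>group_algebra H\<^esub> = group_elem \<one>\<^bsub>H\<^esub>"
  and in_carrier_group_algebra: "f \<in> carrier (group_algebra H)
    \<longleftrightarrow> finite {h. f h \<noteq> 0} \<and> {h. f h \<noteq> 0} \<subseteq> carrier H"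
  by (simp_all add: group_algebra_def group_elem_def)

lemma group_elem_closed [simp, intro]:
  "x \<in> carrier H \<Longrightarrow> group_elem x \<in> carrier (group_algebra H)"
  by (simp add: in_carrier_group_algebra group_elem_def)

lemma group_algebra_smult_closed [simp, intro]:
  assumes "f \<in> carrier (group_algebra H)"
  shows "z \<odot>\<^bsub>group_algebra H\<^esub> f \<in> carrier (group_algebra H)"
proof -
  have "{h. z * f h \<noteq> 0} \<subseteq> {h. f h \<noteq> 0}"
    by auto
  with assms show ?thesis
    by (auto simp: in_carrier_group_algebra intro: finite_subset)
qed

lemma group_algebra_add_closed:
  assumes "f \<in> carrier (group_algebra H)" "g \<in> carrier (group_algebra H)"
  shows "f \<oplus>\<^bsub>group_algebra H\<^esub> g \<in> carrier (group_algebra H)"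
proof -
  have "{h. f h + g h \<noteq> 0} \<subseteq> {h. f h \<noteq> 0} \<union> {h. g h \<noteq> 0}"
    by auto
  with assms show ?thesis
    by (auto simp: in_carrier_group_algebra intro: finite_subset)
qed

lemma group_algebra_smult_mult_left:
  assumes "f \<in> carrier (group_algebra H)" "g \<in> carrier (group_algebra H)"
  shows "(z \<odot>\<^bsub>group_algebra H\<^esub> f) \<otimes>\<^bsub>group_algebra H\<^esub> g
    = z \<odot>\<^bsub>group_algebra H\<^esub> (f \<otimes>\<^bsub>group_algebra H\<^esub> g)"
proof
  fix h
  have "((z \<odot>\<^bsub>group_algebra H\<^esub> f) \<otimes>\<^bsub>group_algebra H\<^esub> g) h
      = (\<Sum>x | f x \<noteq> 0. \<Sum>y | g y \<noteq> 0. if x \<otimes>\<^bsub>H\<^esub> y = h then z * f x * g y else 0)"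
    using assms
    by (subst group_algebra_mult_eq_sum [of "{x. f x \<noteq> 0}" _ "{y. g y \<noteq> 0}"])
      (auto simp: in_carrier_group_algebra intro!: sum.cong)
  also have "\<dots> = z * (f \<otimes>\<^bsub>group_algebra H\<^esub> g) h"
    using assms
    by (subst group_algebra_mult_eq_sum [of "{x. f x \<noteq> 0}" _ "{y. g y \<noteq> 0}"])
      (auto simp: in_carrier_group_algebra sum_distrib_left intro!: sum.cong)
  finally show "((z \<odot>\<^bsub>group_algebra H\<^esub> f) \<otimes>\<^bsub>group_algebra H\<^esub> g) h
      = (z \<odot>\<^bsub>group_algebra H\<^esub> (f \<otimes>\<^bsub>group_algebra H\<^esub> g)) h"
    by simp
qed

lemma group_algebra_smult_mult_right:
  assumes "f \<in> carrier (group_algebra H)" "g \<in> carrier (group_algebra H)"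
  shows "f \<otimes>\<^bsub>group_algebra H\<^esub> (z \<odot>\<^bsub>group_algebra H\<^esub> g)
    = z \<odot>\<^bsub>group_algebra H\<^esub> (f \<otimes>\<^bsub>group_algebra H\<^esub> g)"
proof
  fix h
  have "(f \<otimes>\<^bsub>group_algebra H\<^esub> (z \<odot>\<^bsub>group_algebra H\<^esub> g)) h
      = (\<Sum>x | f x \<noteq> 0. \<Sum>y | g y \<noteq> 0. if x \<otimes>\<^bsub>H\<^esub> y = h then f x * (z * g y) else 0)"
    using assms
    by (subst group_algebra_mult_eq_sum [of "{x. f x \<noteq> 0}" _ "{y. g y \<noteq> 0}"])
      (auto simp: in_carrier_group_algebra intro!: sum.cong)
  also have "\<dots> = z * (f \<otimes>\<^bsub>group_algebra H\<^esub> g) h"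
    using assms
    by (subst group_algebra_mult_eq_sum [of "{x. f x \<noteq> 0}" _ "{y. g y \<noteq> 0}"])
      (auto simp: in_carrier_group_algebra sum_distrib_left intro!: sum.cong)
  finally show "(f \<otimes>\<^bsub>group_algebra H\<^esub> (z \<odot>\<^bsub>group_algebra H\<^esub> g)) h
      = (z \<odot>\<^bsub>group_algebra H\<^esub> (f \<otimes>\<^bsub>group_algebra H\<^esub> g)) h"
    by simp
qed

lemma group_elem_mult:
  "group_elem x \<otimes>\<^bsub>group_algebra H\<^esub> group_elem y = group_elem (x \<otimes>\<^bsub>H\<^esub> y)"
proof
  fix h
  show "(group_elem x \<otimes>\<^bsub>group_algebra H\<^esub> group_elem y) h = group_elem (x \<otimes>\<^bsub>H\<^esub> y) h"
    by (subst group_algebra_mult_eq_sum [of "{x}" _ "{y}"]) (auto simp: group_elem_def)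
qed

lemma abelian_group_group_algebra: "abelian_group (group_algebra H)"
proof (rule abelian_groupI)
  fix f
  assume "f \<in> carrier (group_algebra H)"
  then show "\<exists>g\<in>carrier (group_algebra H). g \<oplus>\<^bsub>group_algebra H\<^esub> f = \<zero>\<^bsub>group_algebra H\<^esub>"
    by (intro bexI [of _ "(- 1) \<odot>\<^bsub>group_algebra H\<^esub> f"]) auto
next
  show "\<zero>\<^bsub>group_algebra H\<^esub> \<in> carrier (group_algebra H)"
    by (simp add: in_carrier_group_algebra)
qed (simp_all add: group_algebra_add_closed fun_eq_iff)

text \<open>The laborious axiom is associativity: both bracketings are reduced to one triple sum
  over the supports. Working over a monoid allows the wreath product to enter without a construction
  of its inverses.\<close>

lemma (in monoid) ring_group_algebra: "ring (group_algebra G)"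
proof (rule ringI [OF abelian_group_group_algebra])
  let ?A = "group_algebra G"
  let ?supp = "\<lambda>f :: 'a \<Rightarrow> complex. {x. f x \<noteq> 0}"
  have fin: "finite (?supp f)" and sub: "?supp f \<subseteq> carrier G" if "f \<in> carrier ?A" for f
    using that by (simp_all add: in_carrier_group_algebra)
  show "monoid ?A"
  proof (rule monoidI)
    fix f g
    assume fg: "f \<in> carrier ?A" "g \<in> carrier ?A"
    have "?supp (f \<otimes>\<^bsub>?A\<^esub> g) \<subseteq> (\<lambda>(x, y). x \<otimes> y) ` (?supp f \<times> ?supp g)"
      by (rule group_algebra_mult_support)
    moreover have "finite ((\<lambda>(x, y). x \<otimes> y) ` (?supp f \<times> ?supp g))"
      using fg by (simp add: fin)
    moreover have "(\<lambda>(x, y). x \<otimes> y) ` (?supp f \<times> ?supp g) \<subseteq> carrier G"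
      using sub [OF fg(1)] sub [OF fg(2)] by auto
    ultimately show "f \<otimes>\<^bsub>?A\<^esub> g \<in> carrier ?A"
      unfolding in_carrier_group_algebra by (meson finite_subset order_trans)
  next
    show "\<one>\<^bsub>?A\<^esub> \<in> carrier ?A"
      by (simp add: group_algebra_one)
  next
    fix f g k
    assume fgk: "f \<in> carrier ?A" "g \<in> carrier ?A" "k \<in> carrier ?A"
    let ?FG = "(\<lambda>(x, y). x \<otimes> y) ` (?supp f \<times> ?supp g)"
    let ?GK = "(\<lambda>(x, y). x \<otimes> y) ` (?supp g \<times> ?supp k)"
    show "(f \<otimes>\<^bsub>?A\<^esub> g) \<otimes>\<^bsub>?A\<^esub> k = f \<otimes>\<^bsub>?A\<^esub> (g \<otimes>\<^bsub>?A\<^esub> k)"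
    proof
      fix h
      have "((f \<otimes>\<^bsub>?A\<^esub> g) \<otimes>\<^bsub>?A\<^esub> k) h
          = (\<Sum>z\<in>?FG. \<Sum>u\<in>?supp k. if z \<otimes> u = h then (f \<otimes>\<^bsub>?A\<^esub> g) z * k u else 0)"
        using fgk by (intro group_algebra_mult_eq_sum group_algebra_mult_support) (auto simp: fin)
      \<comment> \<open>With \<open>k\<close> and \<open>h\<close> fixed, the sum over
        \<open>u\<close> is a function of \<open>z\<close> alone and serves as the test function of
        \<open>sum_group_algebra_mult\<close>.\<close>
      also have "\<dots> = (\<Sum>z\<in>?FG. (f \<otimes>\<^bsub>?A\<^esub> g) z * (\<Sum>u\<in>?supp k. if z \<otimes> u = h then k u else 0))"
        unfolding sum_distrib_left by (intro sum.cong) auto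
      also have "\<dots> = (\<Sum>x\<in>?supp f. \<Sum>y\<in>?supp g.
          f x * g y * (\<Sum>u\<in>?supp k. if (x \<otimes> y) \<otimes> u = h then k u else 0))"
        using fgk
        by (intro sum_group_algebra_mult [where \<phi> = "\<lambda>z. \<Sum>u\<in>?supp k. if z \<otimes> u = h then k u else 0"])
          (auto simp: fin)
      also have "\<dots> = (\<Sum>x\<in>?supp f. \<Sum>y\<in>?supp g. \<Sum>u\<in>?supp k.
          f x * (g y * k u * (if x \<otimes> (y \<otimes> u) = h then 1 else 0)))"
        unfolding sum_distrib_left
        using sub [OF fgk(1)] sub [OF fgk(2)] sub [OF fgk(3)]
        by (intro sum.cong refl) (auto simp: m_assoc subset_iff)
      also have "\<dots> = (\<Sum>x\<in>?supp f. f x * (\<Sum>y\<in>?supp g. \<Sum>u\<in>?supp k.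
          g y * k u * (if x \<otimes> (y \<otimes> u) = h then 1 else 0)))"
        unfolding sum_distrib_left ..
      \<comment> \<open>The same lemma read backwards, with the indicator of
        \<open>x \<otimes> w = h\<close> as test function, collects \<open>y\<close> and
        \<open>u\<close> into \<open>w\<close>.\<close>
      also have "\<dots> = (\<Sum>x\<in>?supp f. f x *
          (\<Sum>w\<in>?GK. (g \<otimes>\<^bsub>?A\<^esub> k) w * (if x \<otimes> w = h then 1 else 0)))"
        using fgk
        by (intro sum.cong refl arg_cong2 [of _ _ _ _ "(*)"]
            sum_group_algebra_mult [where \<phi> = "\<lambda>w. if _ \<otimes> w = h then 1 else 0", symmetric])
          (auto simp: fin)
      also have "\<dots> = (\<Sum>x\<in>?supp f. \<Sum>w\<in>?GK. if x \<otimes> w = h then f x * (g \<otimes>\<^bsub>?A\<^esub> k) w else 0)"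
        unfolding sum_distrib_left by (intro sum.cong) auto
      also have "\<dots> = (f \<otimes>\<^bsub>?A\<^esub> (g \<otimes>\<^bsub>?A\<^esub> k)) h"
        using fgk
        by (intro group_algebra_mult_eq_sum [symmetric] group_algebra_mult_support) (auto simp: fin)
      finally show "((f \<otimes>\<^bsub>?A\<^esub> g) \<otimes>\<^bsub>?A\<^esub> k) h = (f \<otimes>\<^bsub>?A\<^esub> (g \<otimes>\<^bsub>?A\<^esub> k)) h" .
    qed
  next
    fix f
    assume f: "f \<in> carrier ?A"
    show "\<one>\<^bsub>?A\<^esub> \<otimes>\<^bsub>?A\<^esub> f = f"
    proof
      fix h
      have "(\<one>\<^bsub>?A\<^esub> \<otimes>\<^bsub>?A\<^esub> f) h
          = (\<Sum>x\<in>{\<one>}. \<Sum>y\<in>?supp f. if x \<otimes> y = h then \<one>\<^bsub>?A\<^esub> x * f y else 0)"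
        using f by (intro group_algebra_mult_eq_sum) (auto simp: fin group_algebra_one group_elem_def)
      also have "\<dots> = (\<Sum>y\<in>?supp f. if y = h then f y else 0)"
        using sub [OF f]
        by (auto simp: group_algebra_one group_elem_def subset_iff intro!: sum.cong)
      also have "\<dots> = f h"
        using f by (simp add: fin)
      finally show "(\<one>\<^bsub>?A\<^esub> \<otimes>\<^bsub>?A\<^esub> f) h = f h" .
    qed
    show "f \<otimes>\<^bsub>?A\<^esub> \<one>\<^bsub>?A\<^esub> = f"
    proof
      fix h
      have "(f \<otimes>\<^bsub>?A\<^esub> \<one>\<^bsub>?A\<^esub>) h
          = (\<Sum>x\<in>?supp f. \<Sum>y\<in>{\<one>}. if x \<otimes> y = h then f x * \<one>\<^bsub>?A\<^esub> y else 0)"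
        using f by (intro group_algebra_mult_eq_sum) (auto simp: fin group_algebra_one group_elem_def)
      also have "\<dots> = (\<Sum>x\<in>?supp f. if x = h then f x else 0)"
        using sub [OF f]
        by (auto simp: group_algebra_one group_elem_def subset_iff intro!: sum.cong)
      also have "\<dots> = f h"
        using f by (simp add: fin)
      finally show "(f \<otimes>\<^bsub>?A\<^esub> \<one>\<^bsub>?A\<^esub>) h = f h" .
    qed
  qed
next
  let ?A = "group_algebra G"
  let ?supp = "\<lambda>f :: 'a \<Rightarrow> complex. {x. f x \<noteq> 0}"
  fix f g k
  assume fgk: "f \<in> carrier ?A" "g \<in> carrier ?A" "k \<in> carrier ?A"
  \<comment> \<open>One index set for all factors, so that both distributive laws can be checked
    summand by summand.\<close>
  define S where "S = ?supp f \<union> ?supp g \<union> ?supp k"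
  have S: "finite S" "?supp f \<subseteq> S" "?supp g \<subseteq> S" "?supp k \<subseteq> S" "?supp (f \<oplus>\<^bsub>?A\<^esub> g) \<subseteq> S"
    using fgk by (auto simp: S_def in_carrier_group_algebra)
  show "(f \<oplus>\<^bsub>?A\<^esub> g) \<otimes>\<^bsub>?A\<^esub> k = f \<otimes>\<^bsub>?A\<^esub> k \<oplus>\<^bsub>?A\<^esub> g \<otimes>\<^bsub>?A\<^esub> k"
    unfolding fun_eq_iff group_algebra_add
      group_algebra_mult_eq_sum [OF S(1,2) S(1,4)] group_algebra_mult_eq_sum [OF S(1,3) S(1,4)]
      group_algebra_mult_eq_sum [OF S(1,5) S(1,4)]
      sum.distrib [symmetric]
    by (auto intro!: sum.cong simp: distrib_right)
  show "k \<otimes>\<^bsub>?A\<^esub> (f \<oplus>\<^bsub>?A\<^esub> g) = k \<otimes>\<^bsub>?A\<^esub> f \<oplus>\<^bsub>?A\<^esub> k \<otimes>\<^bsub>?A\<^esub> g"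
    unfolding fun_eq_iff group_algebra_add
      group_algebra_mult_eq_sum [OF S(1,4) S(1,2)] group_algebra_mult_eq_sum [OF S(1,4) S(1,3)]
      group_algebra_mult_eq_sum [OF S(1,4) S(1,5)]
      sum.distrib [symmetric]
    by (auto intro!: sum.cong simp: distrib_left)
qed

text \<open>Evaluation at a point turns sums in the algebra into complex sums, which can then be
  reindexed along bijections.\<close>

lemma finsum_group_algebra:
  assumes "finite I" "\<And>i. i \<in> I \<Longrightarrow> f i \<in> carrier (group_algebra H)"
  shows "(\<Oplus>\<^bsub>group_algebra H\<^esub> i\<in>I. f i) h = (\<Sum>i\<in>I. f i h)"
proof -
  interpret abelian_group "group_algebra H"
    by (rule abelian_group_group_algebra)
  show ?thesis
    using assms by (induction I rule: finite_induct) (simp_all add: Pi_def)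
qed

text \<open>Additive inverses are unique, so the abstract one is the scalar multiple by -1, which is
  evaluated pointwise.\<close>

lemma group_algebra_uminus:
  assumes "f \<in> carrier (group_algebra H)"
  shows "(\<ominus>\<^bsub>group_algebra H\<^esub> f) h = - f h"
proof -
  interpret abelian_group "group_algebra H"
    by (rule abelian_group_group_algebra)
  have "\<ominus>\<^bsub>group_algebra H\<^esub> f = (- 1) \<odot>\<^bsub>group_algebra H\<^esub> f"
    using assms by (intro minus_equality) (auto simp: fun_eq_iff)
  then show ?thesis
    by simp
qed

section \<open>Products of scaled sums of group elements\<close>

context monoid
begin

interpretation A: ring "group_algebra G"
  by (rule ring_group_algebra)

lemma group_elem_mult_finsum:
  assumes "x \<in> carrier G" "finite J" "\<And>j. j \<in> J \<Longrightarrow> y j \<in> carrier G"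
  shows "group_elem x \<otimes>\<^bsub>group_algebra G\<^esub>
      (b \<odot>\<^bsub>group_algebra G\<^esub> (\<Oplus>\<^bsub>group_algebra G\<^esub> j\<in>J. group_elem (y j)))
    = b \<odot>\<^bsub>group_algebra G\<^esub> (\<Oplus>\<^bsub>group_algebra G\<^esub> j\<in>J. group_elem (x \<otimes> y j))"
  using assms
  by (simp add: group_algebra_smult_mult_right A.finsum_rdistr Pi_def group_elem_mult A.finsum_closed)

lemma finsum_mult_group_elem:
  assumes "finite I" "\<And>i. i \<in> I \<Longrightarrow> x i \<in> carrier G" "y \<in> carrier G"
  shows "(a \<odot>\<^bsub>group_algebra G\<^esub> (\<Oplus>\<^bsub>group_algebra G\<^esub> i\<in>I. group_elem (x i)))
      \<otimes>\<^bsub>group_algebra G\<^esub> group_elem y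
    = a \<odot>\<^bsub>group_algebra G\<^esub> (\<Oplus>\<^bsub>group_algebra G\<^esub> i\<in>I. group_elem (x i \<otimes> y))"
  using assms
  by (simp add: group_algebra_smult_mult_left A.finsum_ldistr Pi_def group_elem_mult A.finsum_closed)

text \<open>A single sum over index pairs is the form in which two such products can be compared by
  a bijection between the pairs.\<close>

lemma finsum_mult_finsum:
  assumes "finite I" "\<And>i. i \<in> I \<Longrightarrow> x i \<in> carrier G"
    and "finite J" "\<And>j. j \<in> J \<Longrightarrow> y j \<in> carrier G"
  shows "((a \<odot>\<^bsub>group_algebra G\<^esub> (\<Oplus>\<^bsub>group_algebra G\<^esub> i\<in>I. group_elem (x i)))
      \<otimes>\<^bsub>group_algebra G\<^esub> (b \<odot>\<^bsub>group_algebra G\<^esub> (\<Oplus>\<^bsub>group_algebra G\<^esub> j\<in>J. group_elem (y j)))) h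
    = a * b * (\<Sum>(i, j)\<in>I \<times> J. group_elem (x i \<otimes> y j) h)"
proof -
  let ?Y = "b \<odot>\<^bsub>group_algebra G\<^esub> (\<Oplus>\<^bsub>group_algebra G\<^esub> j\<in>J. group_elem (y j))"
  have Y: "?Y \<in> carrier (group_algebra G)"
    using assms by (simp add: A.finsum_closed Pi_def)
  have eq: "(a \<odot>\<^bsub>group_algebra G\<^esub> (\<Oplus>\<^bsub>group_algebra G\<^esub> i\<in>I. group_elem (x i))) \<otimes>\<^bsub>group_algebra G\<^esub> ?Y
      = a \<odot>\<^bsub>group_algebra G\<^esub> (\<Oplus>\<^bsub>group_algebra G\<^esub> i\<in>I. group_elem (x i) \<otimes>\<^bsub>group_algebra G\<^esub> ?Y)"
    using assms Y by (simp add: group_algebra_smult_mult_left A.finsum_ldistr Pi_def A.finsum_closed)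
  have "((a \<odot>\<^bsub>group_algebra G\<^esub> (\<Oplus>\<^bsub>group_algebra G\<^esub> i\<in>I. group_elem (x i))) \<otimes>\<^bsub>group_algebra G\<^esub> ?Y) h
      = a * (\<Sum>i\<in>I. (group_elem (x i) \<otimes>\<^bsub>group_algebra G\<^esub> ?Y) h)"
    unfolding eq using assms Y by (simp add: finsum_group_algebra)
  also have "\<dots> = a * (\<Sum>i\<in>I. b * (\<Sum>j\<in>J. group_elem (x i \<otimes> y j) h))"
    using assms by (simp add: group_elem_mult_finsum finsum_group_algebra)
  also have "\<dots> = a * b * (\<Sum>(i, j)\<in>I \<times> J. group_elem (x i \<otimes> y j) h)"
    by (simp add: sum.cartesian_product sum_distrib_left [symmetric] mult.assoc)
  finally show ?thesis .
qed

end

section \<open>Baxterization in a group algebra\<close>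

text \<open>Here \<open>s, t\<close> play the roles of \<open>s\<^sub>1, s\<^sub>2\<close>, and \<open>p, q, r\<close> those of
  \<open>e\<^sub>1\<^sub>2, e\<^sub>2\<^sub>3, e\<^sub>1\<^sub>3\<close>.\<close>

lemma (in ring) yang_baxter_words:
  assumes closed [simp]: "s \<in> carrier R" "t \<in> carrier R" "p \<in> carrier R" "q \<in> carrier R" "r \<in> carrier R"
    and square: "s \<otimes> s = \<one>" "t \<otimes> t = \<one>"
    and s_move: "s \<otimes> p = p \<otimes> s" "s \<otimes> q = r \<otimes> s" "s \<otimes> r = q \<otimes> s"
    and t_move: "t \<otimes> q = q \<otimes> t" "t \<otimes> p = r \<otimes> t" "t \<otimes> r = p \<otimes> t"
    and cyclic: "q \<otimes> r = p \<otimes> q" "r \<otimes> p = p \<otimes> q" "p \<otimes> r = q \<otimes> p" "r \<otimes> q = q \<otimes> p"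
  shows "p \<otimes> (t \<otimes> s) = t \<otimes> (s \<otimes> q)" "s \<otimes> (q \<otimes> s) = t \<otimes> (p \<otimes> t)" "s \<otimes> (t \<otimes> p) = q \<otimes> (s \<otimes> t)"
    and "p \<otimes> (q \<otimes> s) = q \<otimes> (s \<otimes> q)" "s \<otimes> (q \<otimes> p) = q \<otimes> (s \<otimes> q)"
    and "p \<otimes> (t \<otimes> p) = t \<otimes> (p \<otimes> q)" "q \<otimes> (p \<otimes> t) = t \<otimes> (p \<otimes> q)"
    and "p \<otimes> (q \<otimes> p) = q \<otimes> (p \<otimes> q)"
proof -
  \<comment> \<open>Words are nested to the right, so a relation between two-letter words must also
    be available in front of a tail \<open>z\<close>.\<close>
  have assoc: "a \<otimes> (b \<otimes> z) = c \<otimes> (d \<otimes> z)"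
    if "a \<otimes> b = c \<otimes> d" "a \<in> carrier R" "b \<in> carrier R" "c \<in> carrier R" "d \<in> carrier R" "z \<in> carrier R"
    for a b c d z
    using that by (metis m_assoc)
  note moves = s_move t_move s_move [THEN assoc] t_move [THEN assoc]
  show "p \<otimes> (t \<otimes> s) = t \<otimes> (s \<otimes> q)" "s \<otimes> (q \<otimes> s) = t \<otimes> (p \<otimes> t)" "s \<otimes> (t \<otimes> p) = q \<otimes> (s \<otimes> t)"
    by (simp_all add: moves square)
  show "p \<otimes> (q \<otimes> s) = q \<otimes> (s \<otimes> q)" "s \<otimes> (q \<otimes> p) = q \<otimes> (s \<otimes> q)"
    and "p \<otimes> (t \<otimes> p) = t \<otimes> (p \<otimes> q)" "q \<otimes> (p \<otimes> t) = t \<otimes> (p \<otimes> q)"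
    by (simp_all add: moves cyclic cyclic [THEN assoc])
  \<comment> \<open>\<open>p q p = q r p\<close> by the first cyclic relation, and
    \<open>r p = p q\<close> by the second.\<close>
  show "p \<otimes> (q \<otimes> p) = q \<otimes> (p \<otimes> q)"
    by (metis assoc closed cyclic(1,2))
qed

context monoid
begin

interpretation A: ring "group_algebra G"
  by (rule ring_group_algebra)

lemma group_algebra_yang_baxter:
  fixes u v w :: complex
  defines "A \<equiv> group_algebra G"
  assumes closed: "s \<in> carrier A" "t \<in> carrier A" "p \<in> carrier A" "q \<in> carrier A" "r \<in> carrier A"
    and square: "s \<otimes>\<^bsub>A\<^esub> s = \<one>\<^bsub>A\<^esub>" "t \<otimes>\<^bsub>A\<^esub> t = \<one>\<^bsub>A\<^esub>"
    and braid: "s \<otimes>\<^bsub>A\<^esub> (t \<otimes>\<^bsub>A\<^esub> s) = t \<otimes>\<^bsub>A\<^esub> (s \<otimes>\<^bsub>A\<^esub> t)"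
    and s_move: "s \<otimes>\<^bsub>A\<^esub> p = p \<otimes>\<^bsub>A\<^esub> s" "s \<otimes>\<^bsub>A\<^esub> q = r \<otimes>\<^bsub>A\<^esub> s" "s \<otimes>\<^bsub>A\<^esub> r = q \<otimes>\<^bsub>A\<^esub> s"
    and t_move: "t \<otimes>\<^bsub>A\<^esub> q = q \<otimes>\<^bsub>A\<^esub> t" "t \<otimes>\<^bsub>A\<^esub> p = r \<otimes>\<^bsub>A\<^esub> t" "t \<otimes>\<^bsub>A\<^esub> r = p \<otimes>\<^bsub>A\<^esub> t"
    and cyclic: "q \<otimes>\<^bsub>A\<^esub> r = p \<otimes>\<^bsub>A\<^esub> q" "r \<otimes>\<^bsub>A\<^esub> p = p \<otimes>\<^bsub>A\<^esub> q"
      "p \<otimes>\<^bsub>A\<^esub> r = q \<otimes>\<^bsub>A\<^esub> p" "r \<otimes>\<^bsub>A\<^esub> q = q \<otimes>\<^bsub>A\<^esub> p"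
    and uvw: "u * w = v * (u + w)"
  shows "(s \<oplus>\<^bsub>A\<^esub> u \<odot>\<^bsub>A\<^esub> p) \<otimes>\<^bsub>A\<^esub> (t \<oplus>\<^bsub>A\<^esub> v \<odot>\<^bsub>A\<^esub> q) \<otimes>\<^bsub>A\<^esub> (s \<oplus>\<^bsub>A\<^esub> w \<odot>\<^bsub>A\<^esub> p)
    = (t \<oplus>\<^bsub>A\<^esub> w \<odot>\<^bsub>A\<^esub> q) \<otimes>\<^bsub>A\<^esub> (s \<oplus>\<^bsub>A\<^esub> v \<odot>\<^bsub>A\<^esub> p) \<otimes>\<^bsub>A\<^esub> (t \<oplus>\<^bsub>A\<^esub> u \<odot>\<^bsub>A\<^esub> q)"
proof
  fix h
  \<comment> \<open>The variables \<open>a, b, c, d, e, f\<close> stand for the values at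
    \<open>h\<close> of the words \<open>t s q\<close>, \<open>t p t\<close>, \<open>q s q\<close>,
    \<open>q s t\<close>, \<open>t p q\<close>, \<open>q p q\<close>, to which all words other than
    the braid word are rewritten. The degree 2 words are \<open>c\<close> and \<open>e\<close>: on
    the left they carry \<open>v (u + w)\<close> and \<open>u w\<close>, on the right these
    coefficients are exchanged.\<close>
  have coeffs: "u * a + (v * (b + u * c) + w * (d + (u * e + v * (c + u * f))))
      = w * d + (v * (b + w * e) + u * (a + (w * c + v * (e + w * f))))" for a b c d e f :: complex
  proof -
    have "u * a + (v * (b + u * c) + w * (d + (u * e + v * (c + u * f))))
        - (w * d + (v * (b + w * e) + u * (a + (w * c + v * (e + w * f)))))
      = (e - c) * (u * w - v * (u + w))"
      by (simp add: algebra_simps)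
    then show ?thesis
      by (simp add: uvw)
  qed
  note words = A.yang_baxter_words [folded A_def, OF closed square s_move t_move cyclic]
  note A.ring_simprules [folded A_def, simp]
  note group_algebra_smult_closed [of _ G, folded A_def, simp]
  note group_algebra_smult_mult_left [of _ G, folded A_def, simp]
  note group_algebra_smult_mult_right [of _ G, folded A_def, simp]
  show "((s \<oplus>\<^bsub>A\<^esub> u \<odot>\<^bsub>A\<^esub> p) \<otimes>\<^bsub>A\<^esub> (t \<oplus>\<^bsub>A\<^esub> v \<odot>\<^bsub>A\<^esub> q) \<otimes>\<^bsub>A\<^esub> (s \<oplus>\<^bsub>A\<^esub> w \<odot>\<^bsub>A\<^esub> p)) h
    = ((t \<oplus>\<^bsub>A\<^esub> w \<odot>\<^bsub>A\<^esub> q) \<otimes>\<^bsub>A\<^esub> (s \<oplus>\<^bsub>A\<^esub> v \<odot>\<^bsub>A\<^esub> p) \<otimes>\<^bsub>A\<^esub> (t \<oplus>\<^bsub>A\<^esub> u \<odot>\<^bsub>A\<^esub> q)) h"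
    using closed
    by (simp add: braid words) (simp add: A_def coeffs)
qed

lemma group_algebra_baxterized_commute:
  fixes u v :: complex
  defines "A \<equiv> group_algebra G"
  assumes closed: "s \<in> carrier A" "t \<in> carrier A" "p \<in> carrier A" "q \<in> carrier A"
    and commute: "s \<otimes>\<^bsub>A\<^esub> t = t \<otimes>\<^bsub>A\<^esub> s" "s \<otimes>\<^bsub>A\<^esub> q = q \<otimes>\<^bsub>A\<^esub> s" "t \<otimes>\<^bsub>A\<^esub> p = p \<otimes>\<^bsub>A\<^esub> t" "p \<otimes>\<^bsub>A\<^esub> q = q \<otimes>\<^bsub>A\<^esub> p"
  shows "(s \<oplus>\<^bsub>A\<^esub> u \<odot>\<^bsub>A\<^esub> p) \<otimes>\<^bsub>A\<^esub> (t \<oplus>\<^bsub>A\<^esub> v \<odot>\<^bsub>A\<^esub> q)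
    = (t \<oplus>\<^bsub>A\<^esub> v \<odot>\<^bsub>A\<^esub> q) \<otimes>\<^bsub>A\<^esub> (s \<oplus>\<^bsub>A\<^esub> u \<odot>\<^bsub>A\<^esub> p)"
  using closed commute unfolding A_def fun_eq_iff
  by (simp add: A.l_distr A.r_distr group_algebra_smult_mult_left group_algebra_smult_mult_right
      algebra_simps)

text \<open>The cross terms \<open>u p s\<close> and \<open>- u s p\<close> cancel because
  \<open>s\<close> and \<open>p\<close> commute; what remains is \<open>s s = 1\<close> and the
  quadratic term in \<open>p\<close>.\<close>

lemma group_algebra_baxterized_unitarity:
  fixes u :: complex
  defines "A \<equiv> group_algebra G"
  assumes closed: "s \<in> carrier A" "p \<in> carrier A"
    and "s \<otimes>\<^bsub>A\<^esub> s = \<one>\<^bsub>A\<^esub>" "s \<otimes>\<^bsub>A\<^esub> p = p \<otimes>\<^bsub>A\<^esub> s"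
  shows "(s \<oplus>\<^bsub>A\<^esub> u \<odot>\<^bsub>A\<^esub> p) \<otimes>\<^bsub>A\<^esub> (s \<oplus>\<^bsub>A\<^esub> (- u) \<odot>\<^bsub>A\<^esub> p)
    = \<one>\<^bsub>A\<^esub> \<ominus>\<^bsub>A\<^esub> u\<^sup>2 \<odot>\<^bsub>A\<^esub> (p [^]\<^bsub>A\<^esub> (2::nat))"
proof -
  have "p [^]\<^bsub>A\<^esub> (2::nat) = p \<otimes>\<^bsub>A\<^esub> p"
    using closed by (simp add: A_def numeral_2_eq_2)
  then show ?thesis
    using assms unfolding A_def fun_eq_iff
    by (simp add: A.l_distr A.r_distr group_algebra_smult_mult_left group_algebra_smult_mult_right
        A.minus_eq group_algebra_uminus algebra_simps power2_eq_square)
qed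

end

section \<open>The wreath product\<close>

lemma in_carrier_wreath:
  "(a, \<sigma>) \<in> carrier (wreath G n) \<longleftrightarrow> a \<in> {1..n} \<rightarrow>\<^sub>E carrier G \<and> \<sigma> permutes {1..n}"
  by (simp add: wreath_def semidirect_product_def sym_group_carrier)

lemma wreath_mult:
  "(a, \<sigma>) \<otimes>\<^bsub>wreath G n\<^esub> (b, \<tau>)
    = ((\<lambda>k\<in>{1..n}. a k \<otimes>\<^bsub>G\<^esub> b (inv_into UNIV \<sigma> k)), \<sigma> \<circ> \<tau>)"
  by (auto simp: wreath_def semidirect_product_def sym_group_mult permute_copies_def)

lemma wreath_one: "\<one>\<^bsub>wreath G n\<^esub> = ((\<lambda>k\<in>{1..n}. \<one>\<^bsub>G\<^esub>), id)"
  by (simp add: wreath_def semidirect_product_def sym_group_one)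

lemma (in monoid) monoid_wreath: "monoid (wreath G n)"
proof (rule monoidI)
  \<comment> \<open>The action reads tuples at preimages, so entries stay meaningful only because
    these preimages remain in \<open>{1..n}\<close>.\<close>
  have in_range: "inv_into UNIV \<sigma> k \<in> {1..n} \<longleftrightarrow> k \<in> {1..n}" if "\<sigma> permutes {1..n}" for \<sigma> k
    by (rule permutes_in_image [OF permutes_inv [OF that]])
  show "x \<otimes>\<^bsub>wreath G n\<^esub> y \<in> carrier (wreath G n)"
    if "x \<in> carrier (wreath G n)" "y \<in> carrier (wreath G n)" for x y
  proof -
    obtain a \<sigma> b \<tau> where xy: "x = (a, \<sigma>)" "y = (b, \<tau>)"
      by fastforce
    have perm: "\<sigma> permutes {1..n}" "\<tau> permutes {1..n}"
      and mem: "a \<in> {1..n} \<rightarrow>\<^sub>E carrier G" "b \<in> {1..n} \<rightarrow>\<^sub>E carrier G"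
      using that by (simp_all add: xy in_carrier_wreath)
    have "a k \<otimes> b (inv_into UNIV \<sigma> k) \<in> carrier G" if "k \<in> {1..n}" for k
      using that in_range [OF perm(1), of k]
        PiE_mem [OF mem(1), of k] PiE_mem [OF mem(2), of "inv_into UNIV \<sigma> k"]
      by (intro m_closed) simp_all
    then show ?thesis
      unfolding xy in_carrier_wreath wreath_mult
      using permutes_compose [OF perm(2,1)] by simp
  qed
  show "\<one>\<^bsub>wreath G n\<^esub> \<in> carrier (wreath G n)"
    by (simp add: wreath_one in_carrier_wreath permutes_id)
  show "x \<otimes>\<^bsub>wreath G n\<^esub> y \<otimes>\<^bsub>wreath G n\<^esub> z = x \<otimes>\<^bsub>wreath G n\<^esub> (y \<otimes>\<^bsub>wreath G n\<^esub> z)"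
    if "x \<in> carrier (wreath G n)" "y \<in> carrier (wreath G n)" "z \<in> carrier (wreath G n)" for x y z
  proof -
    obtain a \<sigma> b \<tau> c \<rho> where xyz: "x = (a, \<sigma>)" "y = (b, \<tau>)" "z = (c, \<rho>)"
      by (metis surj_pair)
    have perm: "\<sigma> permutes {1..n}" "\<tau> permutes {1..n}"
      and mem: "a \<in> {1..n} \<rightarrow>\<^sub>E carrier G" "b \<in> {1..n} \<rightarrow>\<^sub>E carrier G" "c \<in> {1..n} \<rightarrow>\<^sub>E carrier G"
      using that by (simp_all add: xyz in_carrier_wreath)
    \<comment> \<open>Inversion reverses composition, which makes the permutation of copies a left
      action: both bracketings read \<open>c\<close> at the same position.\<close>
    have inv: "inv_into UNIV (\<sigma> \<circ> \<tau>) = inv_into UNIV \<tau> \<circ> inv_into UNIV \<sigma>"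
      by (rule o_inv_distrib) (use perm in \<open>auto intro: permutes_bij\<close>)
    have "(a k \<otimes> b (inv_into UNIV \<sigma> k)) \<otimes> c (inv_into UNIV \<tau> (inv_into UNIV \<sigma> k))
        = a k \<otimes> (b (inv_into UNIV \<sigma> k) \<otimes> c (inv_into UNIV \<tau> (inv_into UNIV \<sigma> k)))"
      if "k \<in> {1..n}" for k
    proof -
      have "inv_into UNIV \<sigma> k \<in> {1..n}" "inv_into UNIV \<tau> (inv_into UNIV \<sigma> k) \<in> {1..n}"
        using that perm by (simp_all only: in_range)
      with that show ?thesis
        by (intro m_assoc PiE_mem [OF mem(1)] PiE_mem [OF mem(2)] PiE_mem [OF mem(3)])
    qed
    then show ?thesis
      unfolding xyz wreath_mult inv using in_range [OF perm(1)]
      by (auto simp: comp_assoc simp del: atLeastAtMost_iff intro!: restrict_ext)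
  qed
  \<comment> \<open>Tuples in the carrier are extensional, so the two sides agree outside
    \<open>{1..n}\<close> as well.\<close>
  show "\<one>\<^bsub>wreath G n\<^esub> \<otimes>\<^bsub>wreath G n\<^esub> x = x"
    if "x \<in> carrier (wreath G n)" for x
    using that
    by (cases x) (auto simp: wreath_one wreath_mult in_carrier_wreath PiE_iff extensional_def fun_eq_iff)
  show "x \<otimes>\<^bsub>wreath G n\<^esub> \<one>\<^bsub>wreath G n\<^esub> = x"
    if "x \<in> carrier (wreath G n)" for x
    using that
    by (cases x)
      (auto simp: wreath_one wreath_mult in_carrier_wreath in_range PiE_iff extensional_def fun_eq_iff
        simp del: atLeastAtMost_iff One_nat_def)
qed

section \<open>Transpositions and the summands of \<open>wreath_e\<close>\<close>

context group
begin

lemma wreath_s_closed: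
  assumes "i \<in> {1..n - 1}"
  shows "wreath_s G n i \<in> carrier (wreath G n)"
  using assms
  by (auto simp: wreath_s_def in_carrier_wreath intro!: permutes_swap_id)

text \<open>A transposition is its own inverse, so no \<open>inv_into\<close> remains. The factor
  \<open>\<one>\<close> stays because \<open>b\<close> is arbitrary.\<close>

lemma wreath_s_mult:
  "wreath_s G n i \<otimes>\<^bsub>wreath G n\<^esub> (b, \<tau>)
    = ((\<lambda>k\<in>{1..n}. \<one> \<otimes> b (transpose i (i + 1) k)), transpose i (i + 1) \<circ> \<tau>)"
  unfolding wreath_s_def wreath_mult by (auto simp: fun_eq_iff)

text \<open>Permuting a constant tuple changes nothing, so permutations embed multiplicatively.
  Relations among the \<open>wreath_s\<close> thus reduce to relations among transpositions.\<close>

lemma wreath_perm_mult: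
  assumes "\<sigma> permutes {1..n}"
  shows "((\<lambda>k\<in>{1..n}. \<one>), \<sigma>) \<otimes>\<^bsub>wreath G n\<^esub> ((\<lambda>k\<in>{1..n}. \<one>), \<tau>) = ((\<lambda>k\<in>{1..n}. \<one>), \<sigma> \<circ> \<tau>)"
  unfolding wreath_mult using permutes_in_image [OF permutes_inv [OF assms]]
  by (auto simp del: atLeastAtMost_iff intro!: restrict_ext)

lemma wreath_s_eq: "wreath_s G n i = ((\<lambda>k\<in>{1..n}. \<one>), transpose i (i + 1))"
  by (simp add: wreath_s_def)

lemma wreath_s_square:
  assumes "i \<in> {1..n - 1}"
  shows "wreath_s G n i \<otimes>\<^bsub>wreath G n\<^esub> wreath_s G n i = \<one>\<^bsub>wreath G n\<^esub>"
proof -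
  have "transpose i (i + 1) permutes {1..n}"
    using assms by (intro permutes_swap_id) auto
  then show ?thesis
    unfolding wreath_s_eq wreath_one by (subst wreath_perm_mult) (simp_all del: One_nat_def)
qed

lemma wreath_s_commute:
  assumes "i \<in> {1..n - 1}" "j \<in> {1..n - 1}" "\<bar>int i - int j\<bar> > 1"
  shows "wreath_s G n i \<otimes>\<^bsub>wreath G n\<^esub> wreath_s G n j = wreath_s G n j \<otimes>\<^bsub>wreath G n\<^esub> wreath_s G n i"
proof -
  have perm: "transpose i (i + 1) permutes {1..n}" "transpose j (j + 1) permutes {1..n}"
    using assms by (intro permutes_swap_id; auto)+
  have "transpose i (i + 1) \<circ> transpose j (j + 1) = transpose j (j + 1) \<circ> transpose i (i + 1)"
    using assms(3) by (auto simp: fun_eq_iff transpose_def)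
  then show ?thesis
    unfolding wreath_s_eq wreath_perm_mult [OF perm(1)] wreath_perm_mult [OF perm(2)] by simp
qed

lemma wreath_s_braid:
  assumes "i \<in> {1..n - 2}"
  shows "wreath_s G n i \<otimes>\<^bsub>wreath G n\<^esub> (wreath_s G n (i + 1) \<otimes>\<^bsub>wreath G n\<^esub> wreath_s G n i)
    = wreath_s G n (i + 1) \<otimes>\<^bsub>wreath G n\<^esub> (wreath_s G n i \<otimes>\<^bsub>wreath G n\<^esub> wreath_s G n (i + 1))"
proof -
  let ?s = "transpose i (i + 1)" and ?t = "transpose (i + 1) (i + 1 + 1)"
  have perm: "?s permutes {1..n}" "?t permutes {1..n}"
    using assms by (intro permutes_swap_id; auto)+
  have "?s \<circ> (?t \<circ> ?s) = ?t \<circ> (?s \<circ> ?t)"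
    by (auto simp: fun_eq_iff transpose_def)
  then show ?thesis
    unfolding wreath_s_eq wreath_perm_mult [OF perm(1)] wreath_perm_mult [OF perm(2)] by simp
qed

text \<open>For \<open>i \<noteq> j\<close> this is the product of \<open>g\<close> in position
  \<open>i\<close> and its inverse in position \<open>j\<close>, written as one tuple so that
  products can be compared entry by entry.\<close>

definition wreath_pair :: "nat \<Rightarrow> nat \<Rightarrow> nat \<Rightarrow> 'a \<Rightarrow> (nat \<Rightarrow> 'a) \<times> (nat \<Rightarrow> nat)"
  where "wreath_pair n i j g = ((\<lambda>k\<in>{1..n}. if k = i then g else if k = j then inv g else \<one>), id)"

lemma wreath_pair_closed:
  "g \<in> carrier G \<Longrightarrow> wreath_pair n i j g \<in> carrier (wreath G n)"
  by (auto simp: wreath_pair_def in_carrier_wreath permutes_id)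

lemma wreath_pair_mult:
  "wreath_pair n i j g \<otimes>\<^bsub>wreath G n\<^esub> wreath_pair n k l h
    = ((\<lambda>m\<in>{1..n}. (if m = i then g else if m = j then inv g else \<one>)
        \<otimes> (if m = k then h else if m = l then inv h else \<one>)), id)"
  by (auto simp: wreath_pair_def wreath_mult fun_eq_iff)

text \<open>Brings the average into the shape, a scalar times a sum of group elements, to which
  \<open>finsum_mult_finsum\<close> and its one-sided versions apply.\<close>

lemma wreath_e_eq:
  assumes "i \<noteq> j"
  shows "wreath_e G n i j = (1 / of_nat (order G)) \<odot>\<^bsub>wreath_algebra G n\<^esub>
    (\<Oplus>\<^bsub>wreath_algebra G n\<^esub> g \<in> carrier G. group_elem (wreath_pair n i j g))"
proof -
  interpret A: ring "wreath_algebra G n"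
    by (rule monoid.ring_group_algebra [OF monoid_wreath])
  have "wreath_at G n i g \<otimes>\<^bsub>wreath G n\<^esub> wreath_at G n j (inv g) = wreath_pair n i j g"
    if "g \<in> carrier G" for g
    using assms that by (auto simp: wreath_at_def wreath_pair_def wreath_mult intro!: restrict_ext)
  then show ?thesis
    unfolding wreath_e_def
    by (intro arg_cong [of _ _ "\<lambda>x. _ \<odot>\<^bsub>wreath_algebra G n\<^esub> x"] A.finsum_cong')
      (auto intro!: wreath_pair_closed)
qed

text \<open>Conjugating a tuple by a permutation moves its entries, so the two marked positions are
  carried along by the transposition.\<close>

lemma wreath_s_pair:
  assumes "i \<in> {1..n - 1}" "g \<in> carrier G"
  shows "wreath_s G n i \<otimes>\<^bsub>wreath G n\<^esub> wreath_pair n j k g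
    = wreath_pair n (transpose i (i + 1) j) (transpose i (i + 1) k) g \<otimes>\<^bsub>wreath G n\<^esub> wreath_s G n i"
proof -
  let ?\<pi> = "transpose i (i + 1)"
  have in_range: "?\<pi> m \<in> {1..n} \<longleftrightarrow> m \<in> {1..n}" for m
    using assms by (intro permutes_in_image permutes_swap_id) auto
  \<comment> \<open>Since the transposition is an involution, asking whether \<open>m\<close> is the
    moved position is the same as asking whether \<open>m\<close> is sent to the original
    one.\<close>
  have move: "m = ?\<pi> j \<longleftrightarrow> ?\<pi> m = j" "m = ?\<pi> k \<longleftrightarrow> ?\<pi> m = k" for m
    by (metis transpose_involutory)+
  have "wreath_s G n i \<otimes>\<^bsub>wreath G n\<^esub> wreath_pair n j k g
      = ((\<lambda>m\<in>{1..n}. if ?\<pi> m = j then g else if ?\<pi> m = k then inv g else \<one>), ?\<pi>)"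
    unfolding wreath_pair_def wreath_s_mult using assms(2) in_range
    by (auto simp del: atLeastAtMost_iff intro!: restrict_ext)
  also have "\<dots> = wreath_pair n (?\<pi> j) (?\<pi> k) g \<otimes>\<^bsub>wreath G n\<^esub> wreath_s G n i"
    unfolding wreath_pair_def wreath_s_eq wreath_mult move using assms(2)
    by (auto simp del: atLeastAtMost_iff intro!: restrict_ext)
  finally show ?thesis .
qed

end

section \<open>Relations among the averages \<open>wreath_e\<close>\<close>

locale wreath_of_finite_group = group +
  fixes n :: nat
  assumes finite_carrier: "finite (carrier G)"
begin

interpretation W: monoid "wreath G n"
  by (rule monoid_wreath)

interpretation A: ring "wreath_algebra G n"
  by (rule W.ring_group_algebra)

lemma wreath_e_closed:
  "i \<noteq> j \<Longrightarrow> wreath_e G n i j \<in> carrier (wreath_algebra G n)"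
  by (auto simp: wreath_e_eq intro!: A.finsum_closed wreath_pair_closed)

text \<open>Substituting \<open>inv g\<close> for \<open>g\<close> interchanges the entries in
  positions \<open>i\<close> and \<open>j\<close>.\<close>

lemma wreath_e_sym:
  assumes "i \<noteq> j"
  shows "wreath_e G n i j = wreath_e G n j i"
proof
  fix h
  have "wreath_pair n j i (inv g) = wreath_pair n i j g" if "g \<in> carrier G" for g
    using assms that by (auto simp: wreath_pair_def)
  then have "(\<Sum>g\<in>carrier G. group_elem (wreath_pair n i j g) h)
      = (\<Sum>g\<in>carrier G. group_elem (wreath_pair n j i g) h)"
    by (intro sum.reindex_bij_witness [of _ "\<lambda>g. inv g" "\<lambda>g. inv g"]) auto
  with assms show "wreath_e G n i j h = wreath_e G n j i h"
    by (simp add: wreath_e_eq finsum_group_algebra finite_carrier wreath_pair_closed)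
qed

text \<open>Holds summand by summand through \<open>wreath_s_pair\<close>; injectivity of the
  transposition keeps the two new indices distinct. It supplies the hypotheses \<open>s_move\<close>
  and \<open>t_move\<close> of the abstract Yang--Baxter lemma.\<close>

lemma wreath_s_e:
  assumes "i \<in> {1..n - 1}" "j \<noteq> k"
  shows "group_elem (wreath_s G n i) \<otimes>\<^bsub>wreath_algebra G n\<^esub> wreath_e G n j k
    = wreath_e G n (transpose i (i + 1) j) (transpose i (i + 1) k)
      \<otimes>\<^bsub>wreath_algebra G n\<^esub> group_elem (wreath_s G n i)"
proof
  fix h
  have "transpose i (i + 1) j \<noteq> transpose i (i + 1) k"
    using assms(2) by (metis transpose_involutory)
  then show "(group_elem (wreath_s G n i) \<otimes>\<^bsub>wreath_algebra G n\<^esub> wreath_e G n j k) h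
    = (wreath_e G n (transpose i (i + 1) j) (transpose i (i + 1) k)
      \<otimes>\<^bsub>wreath_algebra G n\<^esub> group_elem (wreath_s G n i)) h"
    using assms
    by (simp add: wreath_e_eq W.group_elem_mult_finsum W.finsum_mult_group_elem finite_carrier
        wreath_pair_closed wreath_s_closed finsum_group_algebra wreath_s_pair)
qed

lemma wreath_e_mult:
  assumes "i \<noteq> j" "k \<noteq> l"
  shows "(wreath_e G n i j \<otimes>\<^bsub>wreath_algebra G n\<^esub> wreath_e G n k l) x
    = (1 / of_nat (order G))\<^sup>2 * (\<Sum>(g, h)\<in>carrier G \<times> carrier G.
        group_elem (wreath_pair n i j g \<otimes>\<^bsub>wreath G n\<^esub> wreath_pair n k l h) x)"
  using assms unfolding power2_eq_square
  by (simp only: wreath_e_eq not_False_eq_True) (intro W.finsum_mult_finsum finite_carrier wreath_pair_closed)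

text \<open>With \<open>g\<^sub>i (g\<^sup>-\<^sup>1 h)\<^sub>j (h\<^sup>-\<^sup>1)\<^sub>k\<close> as the typical summand, the components read in the order
  \<open>i, j, k\<close> multiply to \<open>1\<close>, a condition which is invariant under cyclic rotation.\<close>

lemma wreath_e_cyclic:
  assumes "distinct [i, j, k]"
  shows "wreath_e G n i j \<otimes>\<^bsub>wreath_algebra G n\<^esub> wreath_e G n j k
    = wreath_e G n j k \<otimes>\<^bsub>wreath_algebra G n\<^esub> wreath_e G n k i"
proof
  fix x
  have eq: "wreath_pair n j k (inv g \<otimes> h) \<otimes>\<^bsub>wreath G n\<^esub> wreath_pair n k i (inv g)
      = wreath_pair n i j g \<otimes>\<^bsub>wreath G n\<^esub> wreath_pair n j k h"
    if "g \<in> carrier G" "h \<in> carrier G" for g h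
    using assms that unfolding wreath_pair_mult
    by (auto simp: inv_mult_group m_assoc intro!: restrict_ext)
  have "(\<Sum>(g, h)\<in>carrier G \<times> carrier G.
        group_elem (wreath_pair n i j g \<otimes>\<^bsub>wreath G n\<^esub> wreath_pair n j k h) x)
      = (\<Sum>(g, h)\<in>carrier G \<times> carrier G.
        group_elem (wreath_pair n j k g \<otimes>\<^bsub>wreath G n\<^esub> wreath_pair n k i h) x)"
    \<comment> \<open>Comparing the entries in positions \<open>j\<close> and \<open>i\<close>
      forces the new pair \<open>(inv g \<otimes> h, inv g)\<close>. The other map solves these
      equations for the old pair.\<close>
    by (rule sum.reindex_bij_witness
        [of _ "\<lambda>(g, h). (inv h, inv h \<otimes> g)" "\<lambda>(g, h). (inv g \<otimes> h, inv g)"])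
      (auto simp: eq inv_solve_left m_assoc [symmetric])
  with assms show "(wreath_e G n i j \<otimes>\<^bsub>wreath_algebra G n\<^esub> wreath_e G n j k) x
      = (wreath_e G n j k \<otimes>\<^bsub>wreath_algebra G n\<^esub> wreath_e G n k i) x"
    by (simp add: wreath_e_mult)
qed

text \<open>Elements of the base group with disjoint marked positions commute, so exchanging the two
  summation variables matches the terms.\<close>

lemma wreath_e_commute:
  assumes "distinct [i, j, k, l]"
  shows "wreath_e G n i j \<otimes>\<^bsub>wreath_algebra G n\<^esub> wreath_e G n k l
    = wreath_e G n k l \<otimes>\<^bsub>wreath_algebra G n\<^esub> wreath_e G n i j"
proof
  fix x
  have eq: "wreath_pair n k l h \<otimes>\<^bsub>wreath G n\<^esub> wreath_pair n i j g
      = wreath_pair n i j g \<otimes>\<^bsub>wreath G n\<^esub> wreath_pair n k l h"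
    if "g \<in> carrier G" "h \<in> carrier G" for g h
    using assms that unfolding wreath_pair_mult by (auto intro!: restrict_ext)
  have "(\<Sum>(g, h)\<in>carrier G \<times> carrier G.
        group_elem (wreath_pair n i j g \<otimes>\<^bsub>wreath G n\<^esub> wreath_pair n k l h) x)
      = (\<Sum>(g, h)\<in>carrier G \<times> carrier G.
        group_elem (wreath_pair n k l g \<otimes>\<^bsub>wreath G n\<^esub> wreath_pair n i j h) x)"
    by (rule sum.reindex_bij_witness [of _ "\<lambda>(g, h). (h, g)" "\<lambda>(g, h). (h, g)"]) (auto simp: eq)
  with assms show "(wreath_e G n i j \<otimes>\<^bsub>wreath_algebra G n\<^esub> wreath_e G n k l) x
      = (wreath_e G n k l \<otimes>\<^bsub>wreath_algebra G n\<^esub> wreath_e G n i j) x"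
    by (simp add: wreath_e_mult)
qed

section \<open>The three relations for the Baxterized elements\<close>

lemma baxterized_yang_baxter:
  defines "A \<equiv> wreath_algebra G n" and "s \<equiv> baxterized G n"
  assumes "i \<in> {1..n - 2}" "c \<noteq> c'" "c \<noteq> c''" "c' \<noteq> c''"
  shows "s i c c' \<otimes>\<^bsub>A\<^esub> s (i + 1) c c'' \<otimes>\<^bsub>A\<^esub> s i c' c''
    = s (i + 1) c' c'' \<otimes>\<^bsub>A\<^esub> s i c c'' \<otimes>\<^bsub>A\<^esub> s (i + 1) c c'"
proof -
  let ?e = "wreath_e G n"
  have i: "i \<in> {1..n - 1}" "i + 1 \<in> {1..n - 1}"
    using assms(3) by auto
  have next_index: "i + 1 + 1 = i + 2"
    by simp
  have sym: "?e (i + 1) i = ?e i (i + 1)" "?e (i + 2) (i + 1) = ?e (i + 1) (i + 2)" "?e (i + 2) i = ?e i (i + 2)"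
    by (simp_all add: wreath_e_sym)
  \<comment> \<open>The first two rotations give \<open>p q = q r = r p\<close>; the last two run
    through the indices in the opposite orientation and give \<open>p r = r q = q p\<close>.
    Symmetry of \<open>wreath_e\<close> restores increasing indices.\<close>
  note cyclic = wreath_e_cyclic [of i "i + 1" "i + 2"] wreath_e_cyclic [of "i + 1" "i + 2" i]
    wreath_e_cyclic [of "i + 1" i "i + 2"] wreath_e_cyclic [of i "i + 2" "i + 1"]
  note moves = wreath_s_e [OF i(1), of i "i + 1"] wreath_s_e [OF i(1), of "i + 1" "i + 2"]
    wreath_s_e [OF i(1), of i "i + 2"]
    wreath_s_e [OF i(2), of i "i + 1"] wreath_s_e [OF i(2), of "i + 1" "i + 2"]
    wreath_s_e [OF i(2), of i "i + 2"]
  show ?thesis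
    unfolding A_def s_def baxterized_def next_index
  proof (rule W.group_algebra_yang_baxter [where r = "?e i (i + 2)"])
    \<comment> \<open>Adding the two fractions on the right gives the numerator
      \<open>(c' - c'') + (c - c') = c - c''\<close>, which cancels the first factor.\<close>
    show "1 / (c - c') * (1 / (c' - c'')) = 1 / (c - c'') * (1 / (c - c') + 1 / (c' - c''))"
      using assms by (simp add: field_simps)
  qed (use i moves cyclic sym wreath_s_braid [OF assms(3)] in \<open>simp_all add: wreath_s_closed wreath_e_closed group_elem_mult
      group_algebra_one wreath_s_square transpose_def\<close>)
qed

lemma baxterized_commute:
  defines "A \<equiv> wreath_algebra G n" and "s \<equiv> baxterized G n"
  assumes "i \<in> {1..n - 1}" "j \<in> {1..n - 1}" "\<bar>int i - int j\<bar> > 1"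
  shows "s i c c' \<otimes>\<^bsub>A\<^esub> s j d d' = s j d d' \<otimes>\<^bsub>A\<^esub> s i c c'"
  unfolding A_def s_def baxterized_def
proof (rule W.group_algebra_baxterized_commute)
  \<comment> \<open>The gap between \<open>i\<close> and \<open>j\<close> makes the positions
    \<open>i, i + 1, j, j + 1\<close> distinct, so each transposition also fixes the indices of the
    other average.\<close>
  have ne: "i \<noteq> j" "i \<noteq> j + 1" "i + 1 \<noteq> j"
    using assms(5) by auto
  show "wreath_e G n i (i + 1) \<otimes>\<^bsub>wreath_algebra G n\<^esub> wreath_e G n j (j + 1)
      = wreath_e G n j (j + 1) \<otimes>\<^bsub>wreath_algebra G n\<^esub> wreath_e G n i (i + 1)"
    by (rule wreath_e_commute) (use ne in auto)
  show "group_elem (wreath_s G n i) \<otimes>\<^bsub>wreath_algebra G n\<^esub> wreath_e G n j (j + 1)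
      = wreath_e G n j (j + 1) \<otimes>\<^bsub>wreath_algebra G n\<^esub> group_elem (wreath_s G n i)"
    using ne assms(3) by (simp add: wreath_s_e transpose_def)
  show "group_elem (wreath_s G n j) \<otimes>\<^bsub>wreath_algebra G n\<^esub> wreath_e G n i (i + 1)
      = wreath_e G n i (i + 1) \<otimes>\<^bsub>wreath_algebra G n\<^esub> group_elem (wreath_s G n j)"
    using ne assms(4) by (simp add: wreath_s_e transpose_def)
  show "group_elem (wreath_s G n i) \<otimes>\<^bsub>wreath_algebra G n\<^esub> group_elem (wreath_s G n j)
      = group_elem (wreath_s G n j) \<otimes>\<^bsub>wreath_algebra G n\<^esub> group_elem (wreath_s G n i)"
    using wreath_s_commute [OF assms(3-5)] by (simp add: group_elem_mult)
qed (use assms(3,4) in \<open>simp_all add: wreath_s_closed wreath_e_closed\<close>)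

lemma baxterized_unitarity:
  defines "A \<equiv> wreath_algebra G n" and "s \<equiv> baxterized G n"
  assumes i: "i \<in> {1..n - 1}"
  shows "s i c c' \<otimes>\<^bsub>A\<^esub> s i c' c
    = \<one>\<^bsub>A\<^esub> \<ominus>\<^bsub>A\<^esub> (1 / (c - c')\<^sup>2) \<odot>\<^bsub>A\<^esub> (wreath_e G n i (i + 1) [^]\<^bsub>A\<^esub> (2::nat))"
proof -
  \<comment> \<open>Exchanging the spectral parameters negates the coefficient, giving the pair
    \<open>u\<close>, \<open>- u\<close> of the abstract lemma.\<close>
  have coeffs: "1 / (c' - c) = - (1 / (c - c'))" "1 / (c - c')\<^sup>2 = (1 / (c - c'))\<^sup>2"
    by (simp_all add: power_one_over minus_divide_right)
  \<comment> \<open>Moving \<open>wreath_s\<close> past the average exchanges its indices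
    \<open>i\<close> and \<open>i + 1\<close>, and symmetry exchanges them back, so the two
    commute.\<close>
  show ?thesis
    unfolding A_def s_def baxterized_def coeffs
    by (rule W.group_algebra_baxterized_unitarity)
      (use i wreath_s_e [OF i, of i "i + 1"] in \<open>simp_all add: wreath_s_closed wreath_e_closed
        group_elem_mult wreath_s_square group_algebra_one wreath_e_sym [of "Suc i" i]\<close>)
qed

end

theorem proposition2:
  fixes G (structure) and n :: nat
  assumes "group G" and "finite (carrier G)" and "n \<ge> 1"
  defines "A \<equiv> wreath_algebra G n"
    and "s \<equiv> baxterized G n"
  shows
    "(\<forall>i\<in>{1..n - 2}. \<forall>c c' c''. c \<noteq> c' \<and> c \<noteq> c'' \<and> c' \<noteq> c'' \<longrightarrow>
        s i c c' \<otimes>\<^bsub>A\<^esub> s (i + 1) c c'' \<otimes>\<^bsub>A\<^esub> s i c' c''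
          = s (i + 1) c' c'' \<otimes>\<^bsub>A\<^esub> s i c c'' \<otimes>\<^bsub>A\<^esub> s (i + 1) c c') \<and>
     (\<forall>i\<in>{1..n - 1}. \<forall>j\<in>{1..n - 1}. \<bar>int i - int j\<bar> > 1 \<longrightarrow>
        (\<forall>c c' d d'. c \<noteq> c' \<and> d \<noteq> d' \<longrightarrow>
          s i c c' \<otimes>\<^bsub>A\<^esub> s j d d' = s j d d' \<otimes>\<^bsub>A\<^esub> s i c c')) \<and>
     (\<forall>i\<in>{1..n - 1}. \<forall>c c'. c \<noteq> c' \<longrightarrow>
        s i c c' \<otimes>\<^bsub>A\<^esub> s i c' c
          = \<one>\<^bsub>A\<^esub> \<ominus>\<^bsub>A\<^esub> (1 / (c - c')\<^sup>2) \<odot>\<^bsub>A\<^esub> (wreath_e G n i (i + 1) [^]\<^bsub>A\<^esub> (2::nat)))"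
proof -
  interpret wreath_of_finite_group G n
    by (intro wreath_of_finite_group.intro wreath_of_finite_group_axioms.intro assms)
  show ?thesis
    unfolding A_def s_def
    by (intro conjI ballI allI impI baxterized_yang_baxter baxterized_commute baxterized_unitarity) auto
qed

end
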